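(* Let $\mathbb{K}$ be a field of characteristic $0$ and let $\mathrm{di}\text{-}\mathrm{As}^{\mathrm I}\langle x\rangle$ be the free initial associative dialgebra over $\mathbb{K}$ on one generator $x$. Put $$\mathcal{A}_1=\{x\},\quad \mathcal{A}_2=\{x\vdash x,\ x\dashv x\},\quad \mathcal{A}_3=\{(x\dashv x)\dashv x,\ (x\vdash x)\dashv x\},$$ and, for $n\ge4$, $$\mathcal{A}_n=\{\underbrace{x\dashv x\dashv\cdots\dashv x}_{n}\}$$ (the operation $\dashv$ being associative). Then $\mathcal{A}^I=\bigcup_{n\ge1}\mathcal{A}_n$ is a basis of the vector space $\mathrm{di}\text{-}\mathrm{As}^{\mathrm I}\langle x\rangle$.
   Context: An associative dialgebra is a $\mathbb{K}$-vector space with two bilinear operations $\vdash,\dashv$ satisfying $$a\dashv(b\dashv c)=a\dashv(b\vdash c),\qquad (a\vdash b)\vdash c=(a\dashv b)\vdash c,$$ $$(a\dashv b)\dashv c=a\dashv(b\dashv c),\qquad (a\vdash b)\dashv c=a\vdash(b\dashv c),\qquad (a\vdash b)\vdash c=a\vdash(b\vdash c).$$ It is called initial if, in addition, it satisfies $$(a\vdash b)\vdash c=a\dashv(b\dashv c).$$ $\mathrm{di}\text{-}\mathrm{As}^{\mathrm I}$ denotes the variety of initial associative dialgebras. *)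

theory Defs
  imports Complex_Main
begin

locale assoc_dialgebra = vector_space scale
  for scale :: "'k::field \<Rightarrow> 'a::ab_group_add \<Rightarrow> 'a" +
  fixes rp :: "'a \<Rightarrow> 'a \<Rightarrow> 'a"  (infixl \<open>\<turnstile>\<close> 70)
    and lp :: "'a \<Rightarrow> 'a \<Rightarrow> 'a"  (infixl \<open>\<stileturn>\<close> 70)
  assumes linear_rp_left: "Vector_Spaces.linear scale scale (\<lambda>a. a \<turnstile> b)"
    and linear_rp_right: "Vector_Spaces.linear scale scale (\<lambda>b. a \<turnstile> b)"
    and linear_lp_left: "Vector_Spaces.linear scale scale (\<lambda>a. a \<stileturn> b)"
    and linear_lp_right: "Vector_Spaces.linear scale scale (\<lambda>b. a \<stileturn> b)"
    and lp_bar: "a \<stileturn> (b \<stileturn> c) = a \<stileturn> (b \<turnstile> c)"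
    and rp_bar: "(a \<turnstile> b) \<turnstile> c = (a \<stileturn> b) \<turnstile> c"
    and lp_assoc: "(a \<stileturn> b) \<stileturn> c = a \<stileturn> (b \<stileturn> c)"
    and rp_lp_assoc: "(a \<turnstile> b) \<stileturn> c = a \<turnstile> (b \<stileturn> c)"
    and rp_assoc: "(a \<turnstile> b) \<turnstile> c = a \<turnstile> (b \<turnstile> c)"

locale initial_assoc_dialgebra = assoc_dialgebra +
  assumes initial: "(a \<turnstile> b) \<turnstile> c = a \<stileturn> (b \<stileturn> c)"

definition dialgebra_hom ::
  "('k::field \<Rightarrow> 'a::ab_group_add \<Rightarrow> 'a) \<Rightarrow> ('a \<Rightarrow> 'a \<Rightarrow> 'a) \<Rightarrow> ('a \<Rightarrow> 'a \<Rightarrow> 'a) \<Rightarrow>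
   ('k \<Rightarrow> 'b::ab_group_add \<Rightarrow> 'b) \<Rightarrow> ('b \<Rightarrow> 'b \<Rightarrow> 'b) \<Rightarrow> ('b \<Rightarrow> 'b \<Rightarrow> 'b) \<Rightarrow> ('a \<Rightarrow> 'b) \<Rightarrow> bool"
  where "dialgebra_hom s rp lp s' rp' lp' h \<longleftrightarrow>
    Vector_Spaces.linear s s' h \<and>
    (\<forall>a b. h (rp a b) = rp' (h a) (h b)) \<and> (\<forall>a b. h (lp a b) = lp' (h a) (h b))"

text \<open>
  The free initial associative dialgebra over the field \<open>'k\<close> on the generating set \<open>'x\<close>
  is the algebra of terms in the signature of \<open>'k\<close>-dialgebras, modulo the equations that
  hold in the variety, i.e. modulo the least congruence containing all instances of the
  axioms. That it is a member of the variety and has the universal property is proved in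
  \<open>initial_assoc_dialgebra_free\<close> and \<open>free_universal_property\<close>.
\<close>

datatype ('k, 'x) dterm =
    Gen 'x
  | Zero
  | Add "('k, 'x) dterm" "('k, 'x) dterm"
  | Scale 'k "('k, 'x) dterm"
  | Rp "('k, 'x) dterm" "('k, 'x) dterm"
  | Lp "('k, 'x) dterm" "('k, 'x) dterm"

inductive dterm_eq :: "('k::field, 'x) dterm \<Rightarrow> ('k, 'x) dterm \<Rightarrow> bool"  (infix \<open>\<approx>\<close> 50) where
  refl: "t \<approx> t"
| sym: "t \<approx> u \<Longrightarrow> u \<approx> t"
| trans: "t \<approx> u \<Longrightarrow> u \<approx> v \<Longrightarrow> t \<approx> v"
| cong_Add: "t \<approx> t' \<Longrightarrow> u \<approx> u' \<Longrightarrow> Add t u \<approx> Add t' u'"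
| cong_Scale: "t \<approx> t' \<Longrightarrow> Scale c t \<approx> Scale c t'"
| cong_Rp: "t \<approx> t' \<Longrightarrow> u \<approx> u' \<Longrightarrow> Rp t u \<approx> Rp t' u'"
| cong_Lp: "t \<approx> t' \<Longrightarrow> u \<approx> u' \<Longrightarrow> Lp t u \<approx> Lp t' u'"
| add_assoc: "Add (Add t u) v \<approx> Add t (Add u v)"
| add_commute: "Add t u \<approx> Add u t"
| add_zero: "Add Zero t \<approx> t"
| add_minus: "Add (Scale (-1) t) t \<approx> Zero"
| scale_add_right: "Scale c (Add t u) \<approx> Add (Scale c t) (Scale c u)"
| scale_add_left: "Scale (c + d) t \<approx> Add (Scale c t) (Scale d t)"
| scale_scale: "Scale c (Scale d t) \<approx> Scale (c * d) t"
| scale_one: "Scale 1 t \<approx> t"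
| Rp_add_left: "Rp (Add t u) v \<approx> Add (Rp t v) (Rp u v)"
| Rp_add_right: "Rp t (Add u v) \<approx> Add (Rp t u) (Rp t v)"
| Rp_scale_left: "Rp (Scale c t) u \<approx> Scale c (Rp t u)"
| Rp_scale_right: "Rp t (Scale c u) \<approx> Scale c (Rp t u)"
| Lp_add_left: "Lp (Add t u) v \<approx> Add (Lp t v) (Lp u v)"
| Lp_add_right: "Lp t (Add u v) \<approx> Add (Lp t u) (Lp t v)"
| Lp_scale_left: "Lp (Scale c t) u \<approx> Scale c (Lp t u)"
| Lp_scale_right: "Lp t (Scale c u) \<approx> Scale c (Lp t u)"
| Lp_bar: "Lp t (Lp u v) \<approx> Lp t (Rp u v)"
| Rp_bar: "Rp (Rp t u) v \<approx> Rp (Lp t u) v"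
| Lp_assoc: "Lp (Lp t u) v \<approx> Lp t (Lp u v)"
| Rp_Lp_assoc: "Lp (Rp t u) v \<approx> Rp t (Lp u v)"
| Rp_assoc: "Rp (Rp t u) v \<approx> Rp t (Rp u v)"
| Initial: "Rp (Rp t u) v \<approx> Lp t (Lp u v)"

quotient_type (overloaded) ('k, 'x) free_dialgebra = "('k::field, 'x) dterm" / "dterm_eq"
  by (intro equivpI reflpI sympI transpI) (auto intro: dterm_eq.refl dterm_eq.sym dterm_eq.trans)

instantiation free_dialgebra :: (field, type) ab_group_add
begin

lift_definition zero_free_dialgebra :: "('a, 'b) free_dialgebra" is Zero .

lift_definition plus_free_dialgebra ::
  "('a, 'b) free_dialgebra \<Rightarrow> ('a, 'b) free_dialgebra \<Rightarrow> ('a, 'b) free_dialgebra"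
  is Add by (rule dterm_eq.cong_Add)

lift_definition uminus_free_dialgebra :: "('a, 'b) free_dialgebra \<Rightarrow> ('a, 'b) free_dialgebra"
  is "Scale (-1)" by (rule dterm_eq.cong_Scale)

definition minus_free_dialgebra ::
  "('a, 'b) free_dialgebra \<Rightarrow> ('a, 'b) free_dialgebra \<Rightarrow> ('a, 'b) free_dialgebra"
  where "minus_free_dialgebra a b = a + - b"

instance
proof
  fix a b c :: "('a, 'b) free_dialgebra"
  show "a + b + c = a + (b + c)" by transfer (rule dterm_eq.add_assoc)
  show "a + b = b + a" by transfer (rule dterm_eq.add_commute)
  show "0 + a = a" by transfer (rule dterm_eq.add_zero)
  show "- a + a = 0" by transfer (rule dterm_eq.add_minus)
  show "a - b = a + - b" by (rule minus_free_dialgebra_def)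
qed

end

lift_definition gen :: "'x \<Rightarrow> ('k::field, 'x) free_dialgebra" is Gen .

lift_definition fscale ::
  "'k::field \<Rightarrow> ('k, 'x) free_dialgebra \<Rightarrow> ('k, 'x) free_dialgebra"
  is Scale by (rule dterm_eq.cong_Scale)

lift_definition frp ::
  "('k::field, 'x) free_dialgebra \<Rightarrow> ('k, 'x) free_dialgebra \<Rightarrow> ('k, 'x) free_dialgebra"
  (infixl \<open>\<turnstile>\<close> 70) is Rp by (rule dterm_eq.cong_Rp)

lift_definition flp ::
  "('k::field, 'x) free_dialgebra \<Rightarrow> ('k, 'x) free_dialgebra \<Rightarrow> ('k, 'x) free_dialgebra"
  (infixl \<open>\<stileturn>\<close> 70) is Lp by (rule dterm_eq.cong_Lp)

lemma vector_space_free: "vector_space fscale"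
  by (unfold_locales; transfer; rule dterm_eq.scale_add_right dterm_eq.scale_add_left
      dterm_eq.scale_scale dterm_eq.scale_one)

lemma bilinear_free:
  "(a + b) \<turnstile> c = a \<turnstile> c + b \<turnstile> c"  "fscale k a \<turnstile> b = fscale k (a \<turnstile> b)"
  "a \<turnstile> (b + c) = a \<turnstile> b + a \<turnstile> c"  "a \<turnstile> fscale k b = fscale k (a \<turnstile> b)"
  "(a + b) \<stileturn> c = a \<stileturn> c + b \<stileturn> c"  "fscale k a \<stileturn> b = fscale k (a \<stileturn> b)"
  "a \<stileturn> (b + c) = a \<stileturn> b + a \<stileturn> c"  "a \<stileturn> fscale k b = fscale k (a \<stileturn> b)"
  by (transfer, rule dterm_eq.intros(16-23))+

lemma initial_assoc_dialgebra_free: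
  "initial_assoc_dialgebra (fscale :: 'a::field \<Rightarrow> ('a, 'b) free_dialgebra \<Rightarrow> _) frp flp"
proof -
  have lin: "Vector_Spaces.linear fscale fscale h"
    if "\<And>a b. h (a + b) = h a + h b" "\<And>c a. h (fscale c a) = fscale c (h a)"
    for h :: "('a, 'b) free_dialgebra \<Rightarrow> ('a, 'b) free_dialgebra"
    using that vector_space_free
    by (auto simp: Vector_Spaces.linear_def module_hom_def module_hom_axioms_def
        module_iff_vector_space)
  show ?thesis
  proof (intro initial_assoc_dialgebra.intro assoc_dialgebra.intro assoc_dialgebra_axioms.intro
      initial_assoc_dialgebra_axioms.intro vector_space_free)
    fix a b c :: "('a, 'b) free_dialgebra"
    show "Vector_Spaces.linear fscale fscale (\<lambda>a. a \<turnstile> b)"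
      by (rule lin) (simp_all add: bilinear_free)
    show "Vector_Spaces.linear fscale fscale (\<lambda>b. a \<turnstile> b)"
      by (rule lin) (simp_all add: bilinear_free)
    show "Vector_Spaces.linear fscale fscale (\<lambda>a. a \<stileturn> b)"
      by (rule lin) (simp_all add: bilinear_free)
    show "Vector_Spaces.linear fscale fscale (\<lambda>b. a \<stileturn> b)"
      by (rule lin) (simp_all add: bilinear_free)
    show "a \<stileturn> (b \<stileturn> c) = a \<stileturn> (b \<turnstile> c)" by transfer (rule dterm_eq.Lp_bar)
    show "(a \<turnstile> b) \<turnstile> c = (a \<stileturn> b) \<turnstile> c" by transfer (rule dterm_eq.Rp_bar)
    show "(a \<stileturn> b) \<stileturn> c = a \<stileturn> (b \<stileturn> c)" by transfer (rule dterm_eq.Lp_assoc)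
    show "(a \<turnstile> b) \<stileturn> c = a \<turnstile> (b \<stileturn> c)" by transfer (rule dterm_eq.Rp_Lp_assoc)
    show "(a \<turnstile> b) \<turnstile> c = a \<turnstile> (b \<turnstile> c)" by transfer (rule dterm_eq.Rp_assoc)
    show "(a \<turnstile> b) \<turnstile> c = a \<stileturn> (b \<stileturn> c)" by transfer (rule dterm_eq.Initial)
  qed
qed

primrec dterm_eval ::
  "('k \<Rightarrow> 'a::ab_group_add \<Rightarrow> 'a) \<Rightarrow> ('a \<Rightarrow> 'a \<Rightarrow> 'a) \<Rightarrow> ('a \<Rightarrow> 'a \<Rightarrow> 'a) \<Rightarrow> ('x \<Rightarrow> 'a) \<Rightarrow>
   ('k, 'x) dterm \<Rightarrow> 'a" where
  "dterm_eval s rp lp f (Gen x) = f x"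
| "dterm_eval s rp lp f Zero = 0"
| "dterm_eval s rp lp f (Add t u) = dterm_eval s rp lp f t + dterm_eval s rp lp f u"
| "dterm_eval s rp lp f (Scale c t) = s c (dterm_eval s rp lp f t)"
| "dterm_eval s rp lp f (Rp t u) = rp (dterm_eval s rp lp f t) (dterm_eval s rp lp f u)"
| "dterm_eval s rp lp f (Lp t u) = lp (dterm_eval s rp lp f t) (dterm_eval s rp lp f u)"

lemma (in initial_assoc_dialgebra) dterm_eval_cong:
  "t \<approx> u \<Longrightarrow> dterm_eval scale rp lp f t = dterm_eval scale rp lp f u"
proof (induction rule: dterm_eq.induct)
  case (add_minus t)
  then show ?case by (simp add: scale_minus_left)
next
  case (Rp_bar t u v)
  then show ?case using rp_bar by simp
next
  case (Initial t u v)
  then show ?case using initial by simp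
qed (simp_all add: ac_simps scale_right_distrib scale_left_distrib
    linear_rp_left[THEN Vector_Spaces.linear.axioms(3), THEN module_hom.add]
    linear_rp_right[THEN Vector_Spaces.linear.axioms(3), THEN module_hom.add]
    linear_lp_left[THEN Vector_Spaces.linear.axioms(3), THEN module_hom.add]
    linear_lp_right[THEN Vector_Spaces.linear.axioms(3), THEN module_hom.add]
    linear_rp_left[THEN Vector_Spaces.linear.axioms(3), THEN module_hom.scale]
    linear_rp_right[THEN Vector_Spaces.linear.axioms(3), THEN module_hom.scale]
    linear_lp_left[THEN Vector_Spaces.linear.axioms(3), THEN module_hom.scale]
    linear_lp_right[THEN Vector_Spaces.linear.axioms(3), THEN module_hom.scale]
    rp_assoc rp_lp_assoc lp_assoc lp_bar[symmetric])

theorem free_universal_property: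
  fixes s :: "'k::field \<Rightarrow> 'a::ab_group_add \<Rightarrow> 'a" and f :: "'x \<Rightarrow> 'a"
  assumes "initial_assoc_dialgebra s rp lp"
  shows "\<exists>!h. dialgebra_hom fscale frp flp s rp lp h \<and> (\<forall>x. h (gen x) = f x)"
proof -
  interpret D: initial_assoc_dialgebra s rp lp by fact
  define h where "h a = dterm_eval s rp lp f (rep_free_dialgebra a)" for a
  have h_abs: "h (abs_free_dialgebra t) = dterm_eval s rp lp f t" for t
    unfolding h_def
    by (rule D.dterm_eval_cong)
      (simp add: Quotient3_free_dialgebra dterm_eq.refl rep_abs_rsp_left)
  have hom_iff: "dialgebra_hom fscale frp flp s rp lp g \<longleftrightarrow>
      (\<forall>a b. g (a + b) = g a + g b) \<and> (\<forall>c a. g (fscale c a) = s c (g a)) \<and>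
      (\<forall>a b. g (a \<turnstile> b) = rp (g a) (g b)) \<and> (\<forall>a b. g (a \<stileturn> b) = lp (g a) (g b))"
    for g :: "('k, 'x) free_dialgebra \<Rightarrow> 'a"
    using vector_space_free D.vector_space_axioms
    by (auto simp: dialgebra_hom_def Vector_Spaces.linear_def module_hom_def
        module_hom_axioms_def module_iff_vector_space)
  have ex: "dialgebra_hom fscale frp flp s rp lp h \<and> (\<forall>x. h (gen x) = f x)"
    unfolding hom_iff
  proof (intro conjI allI)
    fix a b :: "('k, 'x) free_dialgebra" and c x
    obtain t u where [simp]: "a = abs_free_dialgebra t" "b = abs_free_dialgebra u"
      by (metis Quotient3_abs_rep Quotient3_free_dialgebra)
    show "h (a + b) = h a + h b" by (simp add: plus_free_dialgebra.abs_eq h_abs)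
    show "h (fscale c a) = s c (h a)" by (simp add: fscale.abs_eq h_abs)
    show "h (a \<turnstile> b) = rp (h a) (h b)" by (simp add: frp.abs_eq h_abs)
    show "h (a \<stileturn> b) = lp (h a) (h b)" by (simp add: flp.abs_eq h_abs)
    show "h (gen x) = f x" by (simp add: gen.abs_eq h_abs)
  qed
  have "g = h" if g: "dialgebra_hom fscale frp flp s rp lp g" "\<forall>x. g (gen x) = f x" for g
  proof
    fix a :: "('k, 'x) free_dialgebra"
    note g' = g(1)[unfolded hom_iff]
    have "g 0 + g 0 = g 0" using g' by (metis add_0)
    then have g0: "g 0 = 0" by simp
    have "g (abs_free_dialgebra t) = dterm_eval s rp lp f t" for t
      by (induction t)
        (use g' g0 g(2) in \<open>simp_all flip: gen.abs_eq zero_free_dialgebra.abs_eq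
          plus_free_dialgebra.abs_eq fscale.abs_eq frp.abs_eq flp.abs_eq\<close>)
    then show "g a = h a"
      by (metis h_abs Quotient3_abs_rep Quotient3_free_dialgebra)
  qed
  with ex show ?thesis by blast
qed

text \<open>
  The free algebra on one generator is the case \<open>'x = unit\<close>. In \<open>lpower a n\<close> exactly \<open>n\<close>
  copies of \<open>a\<close> occur (for \<open>n \<ge> 1\<close>); they are bracketed from the left.
\<close>

definition lpower :: "('k::field, 'x) free_dialgebra \<Rightarrow> nat \<Rightarrow> ('k, 'x) free_dialgebra"
  where "lpower a n = ((\<lambda>b. b \<stileturn> a) ^^ (n - 1)) a"

definition basis_deg :: "nat \<Rightarrow> ('k::field, unit) free_dialgebra set" where
  "basis_deg n = (let x = gen () in
     if n = 1 then {x}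
     else if n = 2 then {x \<turnstile> x, x \<stileturn> x}
     else if n = 3 then {(x \<stileturn> x) \<stileturn> x, (x \<turnstile> x) \<stileturn> x}
     else {lpower x n})"

definition basis_AI :: "('k::field, unit) free_dialgebra set"
  where "basis_AI = (\<Union>n\<in>{1..}. basis_deg n)"

end

(*
  Multiplying a monomial of the proposed basis by x on the right, with either operation, gives
  again a monomial of the basis; since a product with a compound right factor can be rebracketed
  to the left, this makes the span closed under both operations.

  For independence, e2 = x |- x - x -| x and e3 = (x |- x) -| x - (x -| x) -| x are annihilated
  by almost everything, which suggests the multiplication table of a concrete model: polynomials
  without constant term, extended by the two coordinates along e2 and e3. In the image of the free
  algebra in this model the coordinate functionals separate the monomials.
*)
theory Submission
  imports Defs "HOL-Computational_Algebra.Polynomial" "HOL-Library.Product_Plus"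
begin

subsection \<open>The spanning property\<close>

text \<open>Every element is the class of a term, so this is structural induction on terms.\<close>

lemma free_dialgebra_induct [case_names gen zero add scale rp lp]:
  fixes a :: "('k::field, 'x) free_dialgebra"
  assumes "\<And>x. P (gen x)" and "P 0" and "\<And>a b. P a \<Longrightarrow> P b \<Longrightarrow> P (a + b)"
    and "\<And>c a. P a \<Longrightarrow> P (fscale c a)" and "\<And>a b. P a \<Longrightarrow> P b \<Longrightarrow> P (a \<turnstile> b)"
    and "\<And>a b. P a \<Longrightarrow> P b \<Longrightarrow> P (a \<stileturn> b)"
  shows "P a"
proof -
  have "P (abs_free_dialgebra t)" for t
    by (induction t)
      (use assms in \<open>simp_all flip: gen.abs_eq zero_free_dialgebra.abs_eq
        plus_free_dialgebra.abs_eq fscale.abs_eq frp.abs_eq flp.abs_eq\<close>)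
  then show ?thesis
    by (metis Quotient3_abs_rep Quotient3_free_dialgebra)
qed

interpretation free: vector_space "fscale :: 'k::field \<Rightarrow> ('k, 'x) free_dialgebra \<Rightarrow> _"
  by (rule vector_space_free)

interpretation free: initial_assoc_dialgebra
  "fscale :: 'k::field \<Rightarrow> ('k, 'x) free_dialgebra \<Rightarrow> _" frp flp
  by (rule initial_assoc_dialgebra_free)

lemma bilinear_free_zero:
  fixes a :: "('k::field, 'x) free_dialgebra"
  shows "0 \<turnstile> a = 0" "a \<turnstile> 0 = 0" "0 \<stileturn> a = 0" "a \<stileturn> 0 = 0"
  using bilinear_free(2)[of 0 0 a] bilinear_free(4)[of a 0 0]
    bilinear_free(6)[of 0 0 a] bilinear_free(8)[of a 0 0] by simp_all

text \<open>Reduces spanning to right multiplication of elements of \<open>S\<close> by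
  generators.\<close>

lemma span_eq_UNIV_if_right_mult_closed:
  fixes S :: "('k::field, 'x) free_dialgebra set"
  assumes gen: "\<And>x. gen x \<in> S"
    and rp: "\<And>a x. a \<in> S \<Longrightarrow> a \<turnstile> gen x \<in> free.span S"
    and lp: "\<And>a x. a \<in> S \<Longrightarrow> a \<stileturn> gen x \<in> free.span S"
  shows "free.span S = UNIV"
proof -
  have gen_mult: "a \<turnstile> gen x \<in> free.span S \<and> a \<stileturn> gen x \<in> free.span S"
    if "a \<in> free.span S" for a x
    using that
    by (induction rule: free.span_induct_alt)
      (auto simp: bilinear_free bilinear_free_zero rp lp
        intro!: free.span_add free.span_scale free.span_zero)
  have mult: "a \<turnstile> b \<in> free.span S \<and> a \<stileturn> b \<in> free.span S"
    if "a \<in> free.span S" for a b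
    using that
  \<comment> \<open>The left factor stays arbitrary because a compound right factor is split: its
    first factor is absorbed into \<open>a\<close>, and the result is multiplied by the second. For
    \<open>a \<stileturn> (b \<turnstile> c)\<close>, \<open>lp_bar\<close> first replaces the inner
    operation.\<close>
  proof (induction b arbitrary: a rule: free_dialgebra_induct)
    case (rp b c)
    then show ?case
      by (simp flip: free.rp_assoc free.lp_bar free.lp_assoc)
  next
    case (lp b c)
    then show ?case
      by (simp flip: free.rp_lp_assoc free.lp_assoc)
  qed (auto simp: gen_mult bilinear_free bilinear_free_zero
      intro!: free.span_add free.span_scale free.span_zero)
  have "a \<in> free.span S" for a
    by (induction a rule: free_dialgebra_induct)
      (auto simp: mult gen intro: free.span_base free.span_add free.span_scale free.span_zero)
  then show ?thesis by blast
qed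

lemma lpower_1 [simp]: "lpower a (Suc 0) = a"
  by (simp add: lpower_def)

lemma lpower_Suc: "n > 0 \<Longrightarrow> lpower a (Suc n) = lpower a n \<stileturn> a"
  by (cases n) (simp_all add: lpower_def)

lemma basis_AI_eq:
  "(basis_AI :: ('k::field, unit) free_dialgebra set) =
    {gen () \<turnstile> gen (), (gen () \<turnstile> gen ()) \<stileturn> gen ()} \<union> lpower (gen ()) ` {1..}"
    (is "_ = ?E \<union> ?L")
proof -
  let ?x = "gen () :: ('k, unit) free_dialgebra"
  have pow: "lpower ?x 2 = ?x \<stileturn> ?x" "lpower ?x 3 = (?x \<stileturn> ?x) \<stileturn> ?x"
    by (simp_all add: numeral_2_eq_2 numeral_3_eq_3 lpower_Suc)
  have deg: "basis_deg n =
    (if n = 2 then {?x \<turnstile> ?x} else if n = 3 then {(?x \<turnstile> ?x) \<stileturn> ?x} else {}) \<union> {lpower ?x n}"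
    for n :: nat
    using pow by (auto simp: basis_deg_def Let_def)
  have "?E = (\<Union>n\<in>{1::nat..}.
      if n = 2 then {?x \<turnstile> ?x} else if n = 3 then {(?x \<turnstile> ?x) \<stileturn> ?x} else {})"
    by (auto split: if_splits intro: bexI[of _ 2] bexI[of _ 3])
  then show ?thesis
    by (simp only: basis_AI_def deg UN_Un_distrib UNION_singleton_eq_range)
qed

text \<open>The axiom \<open>initial\<close> is used twice on a product of four factors: backwards
  with \<open>a \<turnstile> b\<close> as one factor, then, after rebracketing, forwards with
  \<open>a\<close> and \<open>b\<close> separate. This removes the remaining
  \<open>\<turnstile>\<close> from degree 4 on.\<close>

lemma rp_lp_lp_eq_lp_lp_lp:
  fixes a :: "('k::field, 'x) free_dialgebra"
  shows "(a \<turnstile> b) \<stileturn> c \<stileturn> d = a \<stileturn> b \<stileturn> c \<stileturn> d"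
proof -
  have "(a \<turnstile> b) \<stileturn> c \<stileturn> d = ((a \<turnstile> b) \<turnstile> c) \<turnstile> d"
    by (simp only: free.lp_assoc free.initial[of "a \<turnstile> b"])
  also have "\<dots> = (a \<turnstile> b) \<turnstile> (c \<turnstile> d)"
    by (rule free.rp_assoc)
  also have "\<dots> = a \<stileturn> (b \<stileturn> (c \<turnstile> d))"
    by (rule free.initial)
  also have "\<dots> = a \<stileturn> b \<stileturn> c \<stileturn> d"
    by (simp add: free.lp_assoc flip: free.lp_bar)
  finally show ?thesis .
qed

lemma lp_rp_eq_lp_lp:
  fixes a :: "('k::field, 'x) free_dialgebra"
  shows "(a \<stileturn> b) \<turnstile> c = a \<stileturn> b \<stileturn> c"
  by (metis free.initial free.rp_bar free.lp_assoc)

lemma span_basis_AI: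
  "free.span (basis_AI :: ('k::field, unit) free_dialgebra set) = UNIV"
proof (rule span_eq_UNIV_if_right_mult_closed)
  let ?x = "gen () :: ('k, unit) free_dialgebra"
  have pow_in: "lpower ?x n \<in> basis_AI" if "n > 0" for n
    using that by (auto simp: basis_AI_eq)
  show "gen u \<in> (basis_AI :: ('k, unit) free_dialgebra set)" for u
    using pow_in[of 1] by simp
  fix a :: "('k, unit) free_dialgebra" and u
  assume a: "a \<in> basis_AI"
  have pow3: "lpower ?x 3 = ?x \<stileturn> ?x \<stileturn> ?x" and pow4: "lpower ?x 4 = ?x \<stileturn> ?x \<stileturn> ?x \<stileturn> ?x"
    by (simp_all add: eval_nat_numeral lpower_Suc)
  \<comment> \<open>The generator is kept apart from the higher powers: these end in
    \<open>\<stileturn> x\<close>, so \<open>lp_rp_eq_lp_lp\<close> turns both products into the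
    next power.\<close>
  consider "a = ?x \<turnstile> ?x" | "a = (?x \<turnstile> ?x) \<stileturn> ?x" | "a = ?x"
    | m where "m > 0" "a = lpower ?x (Suc m)"
  proof -
    have "\<exists>m>0. a = lpower ?x (Suc m)" if "a = lpower ?x n" "n \<ge> 1" "a \<noteq> ?x" for n
    proof (intro exI[of _ "n - 1"] conjI)
      have "n \<noteq> 1" using that by auto
      then show "n - 1 > 0" "a = lpower ?x (Suc (n - 1))" using that by auto
    qed
    with a that show thesis unfolding basis_AI_eq by blast
  qed
  then have "a \<turnstile> ?x \<in> basis_AI \<and> a \<stileturn> ?x \<in> basis_AI"
  proof cases
    case 1
    moreover have "?x \<turnstile> ?x \<turnstile> ?x = lpower ?x 3"
      by (simp add: pow3 free.initial free.lp_assoc)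
    ultimately show ?thesis
      using pow_in[of 3] by (auto simp: basis_AI_eq)
  next
    case 2
    then have "a \<turnstile> ?x = lpower ?x 4" "a \<stileturn> ?x = lpower ?x 4"
      by (simp_all add: lp_rp_eq_lp_lp rp_lp_lp_eq_lp_lp_lp pow4)
    then show ?thesis
      using pow_in[of 4] by simp
  next
    case 3
    then show ?thesis
      using pow_in[of 2] by (auto simp: basis_AI_eq numeral_2_eq_2 lpower_Suc)
  next
    case (4 m)
    then have "a \<turnstile> ?x = lpower ?x (Suc (Suc m))" "a \<stileturn> ?x = lpower ?x (Suc (Suc m))"
      by (simp_all add: lpower_Suc lp_rp_eq_lp_lp)
    then show ?thesis
      using pow_in[of "Suc (Suc m)"] by simp
  qed
  then show "a \<turnstile> gen u \<in> free.span basis_AI" "a \<stileturn> gen u \<in> free.span basis_AI"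
    by (simp_all add: free.span_base)
qed

subsection \<open>A model separating the basis\<close>

text \<open>
  The triple \<open>(p, u, v)\<close> stands for \<open>X * p + u e2 + v e3\<close>, so \<open>coeff p n\<close> belongs to the
  left power of exponent \<open>n + 1\<close>. The tables encode \<open>x \<turnstile> x = X\<^sup>2 + e2\<close>,
  \<open>x \<turnstile> (x \<stileturn> x) = X\<^sup>3 + e3\<close>, \<open>x \<turnstile> e2 = - e3\<close> and \<open>e2 \<stileturn> x = e3\<close>; every other product
  of monomials has no \<open>e2\<close> or \<open>e3\<close> part.
\<close>

fun model_scale :: "'k::field \<Rightarrow> 'k poly \<times> 'k \<times> 'k \<Rightarrow> 'k poly \<times> 'k \<times> 'k" where
  "model_scale c (p, u, v) = (smult c p, c * u, c * v)"

fun model_rp :: "'k::field poly \<times> 'k \<times> 'k \<Rightarrow> 'k poly \<times> 'k \<times> 'k \<Rightarrow> 'k poly \<times> 'k \<times> 'k" where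
  "model_rp (p, u, v) (q, u', v') =
    (pCons 0 (p * q), coeff p 0 * coeff q 0, coeff p 0 * (coeff q 1 - u'))"

fun model_lp :: "'k::field poly \<times> 'k \<times> 'k \<Rightarrow> 'k poly \<times> 'k \<times> 'k \<Rightarrow> 'k poly \<times> 'k \<times> 'k" where
  "model_lp (p, u, v) (q, u', v') = (pCons 0 (p * q), 0, u * coeff q 0)"

interpretation model: vector_space "model_scale :: 'k::field \<Rightarrow> _"
  by unfold_locales (auto simp: algebra_simps smult_add_right smult_add_left)

text \<open>The polynomial parts agree since polynomial multiplication is associative. The other
  coordinates of these triple products vanish, except that both sides of \<open>rp_lp_assoc\<close>
  have as last coordinate the product of the three constant coefficients. In \<open>rp_assoc\<close>
  the term \<open>- u'\<close> cancels \<open>coeff q 1\<close>.\<close>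

lemma initial_assoc_dialgebra_model:
  "initial_assoc_dialgebra (model_scale :: 'k::field \<Rightarrow> _) model_rp model_lp"
proof unfold_locales
  fix a b c :: "'k poly \<times> 'k \<times> 'k"
  show "model_lp a (model_lp b c) = model_lp a (model_rp b c)"
    and "model_rp (model_rp a b) c = model_rp (model_lp a b) c"
    and "model_lp (model_lp a b) c = model_lp a (model_lp b c)"
    and "model_lp (model_rp a b) c = model_rp a (model_lp b c)"
    and "model_rp (model_rp a b) c = model_rp a (model_rp b c)"
    and "model_rp (model_rp a b) c = model_lp a (model_lp b c)"
    by (cases a; cases b; cases c; simp add: coeff_mult_0 algebra_simps)+
qed (auto simp: algebra_simps smult_add_right)

subsection \<open>Independence\<close>

text \<open>Each \<open>\<phi> b\<close> is linear and kills the span of the other elements, but not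
  \<open>b\<close>.\<close>

lemma (in vector_space) independent_if_dual_functionals:
  assumes add: "\<And>b x y. b \<in> S \<Longrightarrow> \<phi> b (x + y) = \<phi> b x + \<phi> b y"
    and scale: "\<And>b c x. b \<in> S \<Longrightarrow> \<phi> b (scale c x) = c * \<phi> b x"
    and diag: "\<And>b. b \<in> S \<Longrightarrow> \<phi> b b \<noteq> 0"
    and off: "\<And>b b'. b \<in> S \<Longrightarrow> b' \<in> S \<Longrightarrow> b' \<noteq> b \<Longrightarrow> \<phi> b b' = 0"
  shows "independent S"
  unfolding dependent_def
proof clarify
  fix b assume b: "b \<in> S" "b \<in> span (S - {b})"
  have "\<phi> b y = 0" if "y \<in> span (S - {b})" for y
    using that
  proof (induction rule: span_induct_alt)
    case base
    then show ?case using scale[OF b(1), of 0 0] by simp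
  next
    case (step c x y)
    then show ?case using b(1) by (simp add: add scale off)
  qed
  with diag b show False by blast
qed

lemma independent_basis_AI:
  "free.independent (basis_AI :: ('k::field, unit) free_dialgebra set)"
proof -
  let ?x = "gen () :: ('k, unit) free_dialgebra"
  obtain h :: "('k, unit) free_dialgebra \<Rightarrow> 'k poly \<times> 'k \<times> 'k"
    where hom: "dialgebra_hom fscale frp flp model_scale model_rp model_lp h"
      and hx: "h ?x = (1, 0, 0)"
    using free_universal_property[OF initial_assoc_dialgebra_model, where f = "\<lambda>_. (1, 0, 0)"]
    by blast
  have h_rp: "h (a \<turnstile> b) = model_rp (h a) (h b)" and h_lp: "h (a \<stileturn> b) = model_lp (h a) (h b)"
    for a b using hom by (simp_all add: dialgebra_hom_def)
  interpret h: Vector_Spaces.linear fscale model_scale h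
    using hom by (simp add: dialgebra_hom_def)
  have h_pow: "h (lpower ?x (Suc n)) = (monom 1 n, 0, 0)" for n
    by (induction n) (simp_all add: hx h_lp lpower_Suc monom_Suc one_pCons monom_0)
  have h_y: "h (?x \<turnstile> ?x) = (monom 1 1, 1, 0)" and h_q: "h ((?x \<turnstile> ?x) \<stileturn> ?x) = (monom 1 2, 0, 1)"
    by (simp_all add: hx h_rp h_lp monom_Suc monom_0 one_pCons numeral_2_eq_2)
  \<comment> \<open>Coefficient \<open>n\<close> detects the power of exponent \<open>n + 1\<close>.
    The images of \<open>x \<turnstile> x\<close> and
    \<open>(x \<turnstile> x) \<stileturn> x\<close> also contain \<open>monom 1 1\<close> and
    \<open>monom 1 2\<close>; subtracting \<open>u\<close> or \<open>v\<close> cancels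
    these.\<close>
  define \<psi> where "\<psi> n a = (case h a of (p, u, v) \<Rightarrow>
      coeff p n - (if n = 1 then u else if n = 2 then v else 0))" for n a
  define \<phi> where "\<phi> b = (if b = ?x \<turnstile> ?x then fst \<circ> snd \<circ> h
      else if b = (?x \<turnstile> ?x) \<stileturn> ?x then snd \<circ> snd \<circ> h
      else \<psi> (SOME n. b = lpower ?x (Suc n)))" for b
  have basis: "(basis_AI :: ('k, unit) free_dialgebra set) =
      {?x \<turnstile> ?x, (?x \<turnstile> ?x) \<stileturn> ?x} \<union> range (\<lambda>n. lpower ?x (Suc n))"
  proof -
    have "{1..} = range Suc"
      by (auto simp: image_iff Suc_le_eq gr0_conv_Suc)
    then show ?thesis
      by (simp add: basis_AI_eq image_image)
  qed
  have yq: "(?x \<turnstile> ?x) \<stileturn> ?x \<noteq> ?x \<turnstile> ?x" "lpower ?x (Suc n) \<noteq> ?x \<turnstile> ?x"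
    "lpower ?x (Suc n) \<noteq> (?x \<turnstile> ?x) \<stileturn> ?x" for n
    by (rule notI, drule arg_cong[of _ _ h], simp add: h_pow h_y h_q)+
  have "m = n" if "lpower ?x (Suc m) = lpower ?x (Suc n)" for m n
    using arg_cong[OF that, of h] by (simp add: h_pow monom_eq_iff')
  \<comment> \<open>A power determines its exponent, so \<open>SOME\<close> returns the intended
    \<open>n\<close>.\<close>
  then have \<phi>_pow: "\<phi> (lpower ?x (Suc n)) = \<psi> n" for n
    unfolding \<phi>_def using yq by (metis (mono_tags, lifting) someI)
  have \<phi>_yq: "\<phi> (?x \<turnstile> ?x) = fst \<circ> snd \<circ> h" "\<phi> ((?x \<turnstile> ?x) \<stileturn> ?x) = snd \<circ> snd \<circ> h"
    using yq by (simp_all add: \<phi>_def)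
  show ?thesis
  proof (rule free.independent_if_dual_functionals[where \<phi> = \<phi>])
    fix a b :: "('k, unit) free_dialgebra" and c
    show "\<phi> b (a + a') = \<phi> b a + \<phi> b a'" for a'
      by (cases "h a"; cases "h a'") (simp add: \<phi>_def \<psi>_def h.add)
    show "\<phi> b (fscale c a) = c * \<phi> b a"
      by (cases "h a") (simp add: \<phi>_def \<psi>_def h.scale algebra_simps)
    assume b: "b \<in> basis_AI"
    then show "\<phi> b b \<noteq> 0"
      by (auto simp: basis \<phi>_pow \<phi>_yq \<psi>_def h_pow h_y h_q split: if_splits)
    fix b' assume "b' \<in> basis_AI" "b' \<noteq> b"
    with b show "\<phi> b b' = 0"
      by (auto simp: basis \<phi>_pow \<phi>_yq \<psi>_def h_pow h_y h_q)
  qed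
qed

theorem theorem4p6:
  shows "module.independent fscale
      (basis_AI :: ('k::field_char_0, unit) free_dialgebra set) \<and>
    module.span fscale (basis_AI :: ('k, unit) free_dialgebra set) = UNIV"
  using independent_basis_AI span_basis_AI by blast

end
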